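(* Let $\Omega\subset\mathbb{H}$ be a symmetric slice domain and let $f\in\mathcal{S}(\Omega)\setminus\mathcal{S}_{\mathbb{R}}(\Omega)$. The following are equivalent: (i) $f$ is one-slice preserving; (ii) $f_{v}^{s}$ has a square root $\sqrt{f_{v}^{s}}\in\mathcal{S}_{\mathbb{R}}(\Omega)$ and the map $\frac{f_{v}}{\sqrt{f_{v}^{s}}}$ is constant outside the zero set of $f_{v}^{s}$; (iii) the map $\Omega\cap\mathbb{R}\ni x\mapsto[f_{v}(x)]\in\mathbb{P}(\mathrm{Im}\,\mathbb{H})$ is constant outside the zero set of $f_{v}$.
   Context: $\mathbb{H}$ is the algebra of quaternions with standard basis $1,i,j,k$, $\mathrm{Im}\,\mathbb{H}=\mathrm{Span}_{\mathbb{R}}(i,j,k)$, $\mathbb{P}(\mathrm{Im}\,\mathbb{H})$ its real projectivization, $\mathbb{S}=\{q\in\mathbb{H}: q^2=-1\}$, and $\mathbb{C}_I=\mathrm{Span}_{\mathbb{R}}(1,I)$ for $I\in\mathbb{S}$. A symmetric slice domain $\Omega\subset\mathbb{H}$ is a domain (connected open set) such that $\Omega\cap\mathbb{R}\neq\emptyset$ and, whenever $\alpha+I\beta\in\Omega$ ($\alpha,\beta\in\mathbb{R}$, $I\in\mathbb{S}$), also $\alpha+J\beta\in\Omega$ for all $J\in\mathbb{S}$. A function $f:\Omega\to\mathbb{H}$ is slice regular if for every $J\in\mathbb{S}$ the restriction $f_J$ of $f$ to $\Omega\cap\mathbb{C}_J$ is holomorphic: $\frac12\left(\frac{\partial}{\partial\alpha}+J\frac{\partial}{\partial\beta}\right)f_J(\alpha+J\beta)\equiv0$.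 $\mathcal{S}(\Omega)$ is the set of slice regular functions on $\Omega$; $\mathcal{S}_{\mathbb{R}}(\Omega)$ is the subset of slice preserving functions, i.e. $f(\Omega\cap\mathbb{C}_I)\subset\mathbb{C}_I$ for all $I\in\mathbb{S}$; $f\in\mathcal{S}(\Omega)$ is one-slice preserving if $f(\Omega\cap\mathbb{C}_J)\subset\mathbb{C}_J$ for some $J\in\mathbb{S}$. Known fact: every $f\in\mathcal{S}(\Omega)$ is written uniquely as $f=f_0+f_1i+f_2j+f_3k$ with $f_0,\dots,f_3\in\mathcal{S}_{\mathbb{R}}(\Omega)$ (slice preserving functions take real values at real points). The vectorial part of $f$ is $f_v=f_1i+f_2j+f_3k$ and its symmetrized function is $f_v^s=f_1^2+f_2^2+f_3^2\in\mathcal{S}_{\mathbb{R}}(\Omega)$ (pointwise products). A square root of $\mu\in\mathcal{S}_{\mathbb{R}}(\Omega)$ is a $\sigma\in\mathcal{S}_{\mathbb{R}}(\Omega)$ with $\sigma^2=\mu$. *)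

theory Defs
  imports "HOL-Analysis.Analysis"
begin

section \<open>The real normed division algebra of quaternions\<close>

datatype quat = Quat (Q0: real) (Q1: real) (Q2: real) (Q3: real)

lemma quat_eq_iff: "p = q \<longleftrightarrow> Q0 p = Q0 q \<and> Q1 p = Q1 q \<and> Q2 p = Q2 q \<and> Q3 p = Q3 q"
  by (cases p; cases q) auto

instantiation quat :: ab_group_add
begin

definition zero_quat :: quat where "0 = Quat 0 0 0 0"

definition plus_quat :: "quat \<Rightarrow> quat \<Rightarrow> quat" where
  "p + q = Quat (Q0 p + Q0 q) (Q1 p + Q1 q) (Q2 p + Q2 q) (Q3 p + Q3 q)"

definition uminus_quat :: "quat \<Rightarrow> quat" where
  "- p = Quat (- Q0 p) (- Q1 p) (- Q2 p) (- Q3 p)"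

definition minus_quat :: "quat \<Rightarrow> quat \<Rightarrow> quat" where
  "p - q = Quat (Q0 p - Q0 q) (Q1 p - Q1 q) (Q2 p - Q2 q) (Q3 p - Q3 q)"

instance
  by standard (simp_all add: zero_quat_def plus_quat_def uminus_quat_def minus_quat_def quat_eq_iff)

end

lemma quat_sel_zero [simp]: "Q0 0 = 0" "Q1 0 = 0" "Q2 0 = 0" "Q3 0 = 0"
  by (simp_all add: zero_quat_def)

lemma quat_sel_plus [simp]:
  "Q0 (p + q) = Q0 p + Q0 q" "Q1 (p + q) = Q1 p + Q1 q"
  "Q2 (p + q) = Q2 p + Q2 q" "Q3 (p + q) = Q3 p + Q3 q"
  by (simp_all add: plus_quat_def)

lemma quat_sel_uminus [simp]:
  "Q0 (- p) = - Q0 p" "Q1 (- p) = - Q1 p" "Q2 (- p) = - Q2 p" "Q3 (- p) = - Q3 p"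
  by (simp_all add: uminus_quat_def)

lemma quat_sel_minus [simp]:
  "Q0 (p - q) = Q0 p - Q0 q" "Q1 (p - q) = Q1 p - Q1 q"
  "Q2 (p - q) = Q2 p - Q2 q" "Q3 (p - q) = Q3 p - Q3 q"
  by (simp_all add: minus_quat_def)

instantiation quat :: division_ring
begin

definition one_quat :: quat where "1 = Quat 1 0 0 0"

definition times_quat :: "quat \<Rightarrow> quat \<Rightarrow> quat" where
  "p * q = Quat
     (Q0 p * Q0 q - Q1 p * Q1 q - Q2 p * Q2 q - Q3 p * Q3 q)
     (Q0 p * Q1 q + Q1 p * Q0 q + Q2 p * Q3 q - Q3 p * Q2 q)
     (Q0 p * Q2 q - Q1 p * Q3 q + Q2 p * Q0 q + Q3 p * Q1 q)
     (Q0 p * Q3 q + Q1 p * Q2 q - Q2 p * Q1 q + Q3 p * Q0 q)"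

definition inverse_quat :: "quat \<Rightarrow> quat" where
  "inverse p = (let n = (Q0 p)\<^sup>2 + (Q1 p)\<^sup>2 + (Q2 p)\<^sup>2 + (Q3 p)\<^sup>2
     in Quat (Q0 p / n) (- Q1 p / n) (- Q2 p / n) (- Q3 p / n))"

definition divide_quat :: "quat \<Rightarrow> quat \<Rightarrow> quat" where
  "divide_quat p q = p * inverse q"

lemma quat_normsq_eq_0:
  "(Q0 p)\<^sup>2 + (Q1 p)\<^sup>2 + (Q2 p)\<^sup>2 + (Q3 p)\<^sup>2 = 0 \<longleftrightarrow> p = 0"
  by (simp add: quat_eq_iff add_nonneg_eq_0_iff)

instance
proof
  fix a b c :: quat
  show "a * b * c = a * (b * c)"
    by (simp add: times_quat_def algebra_simps)
  show "1 * a = a" "a * 1 = a"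
    by (simp_all add: one_quat_def times_quat_def quat_eq_iff)
  show "(a + b) * c = a * c + b * c" "a * (b + c) = a * b + a * c"
    by (simp_all add: times_quat_def quat_eq_iff algebra_simps)
  show "(0::quat) \<noteq> 1"
    by (simp add: quat_eq_iff one_quat_def)
  show "a div b = a * inverse b"
    by (simp add: divide_quat_def)
  show "inverse (0::quat) = 0"
    by (simp add: inverse_quat_def quat_eq_iff)
  assume "a \<noteq> 0"
  then have n: "(Q0 a)\<^sup>2 + (Q1 a)\<^sup>2 + (Q2 a)\<^sup>2 + (Q3 a)\<^sup>2 \<noteq> 0"
    by (simp add: quat_normsq_eq_0)
  define n where "n = (Q0 a)\<^sup>2 + (Q1 a)\<^sup>2 + (Q2 a)\<^sup>2 + (Q3 a)\<^sup>2"
  have n0: "n \<noteq> 0"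
    using n by (simp add: n_def)
  have inv: "inverse a = Quat (Q0 a / n) (- Q1 a / n) (- Q2 a / n) (- Q3 a / n)"
    by (simp add: inverse_quat_def n_def Let_def)
  have n_eq: "Q0 a * Q0 a + Q1 a * Q1 a + Q2 a * Q2 a + Q3 a * Q3 a = n"
    by (simp add: n_def power2_eq_square)
  have one: "Q0 a * Q0 a / n + Q1 a * Q1 a / n + Q2 a * Q2 a / n + Q3 a * Q3 a / n = 1"
    using n0 n_eq by (simp add: add_divide_distrib [symmetric])
  show "inverse a * a = 1" "a * inverse a = 1"
    using one by (simp_all add: inv times_quat_def one_quat_def mult.commute)
qed

end

lemma quat_sel_one [simp]: "Q0 1 = 1" "Q1 1 = 0" "Q2 1 = 0" "Q3 1 = 0"
  by (simp_all add: one_quat_def)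

lemma quat_sel_times:
  "Q0 (p * q) = Q0 p * Q0 q - Q1 p * Q1 q - Q2 p * Q2 q - Q3 p * Q3 q"
  "Q1 (p * q) = Q0 p * Q1 q + Q1 p * Q0 q + Q2 p * Q3 q - Q3 p * Q2 q"
  "Q2 (p * q) = Q0 p * Q2 q - Q1 p * Q3 q + Q2 p * Q0 q + Q3 p * Q1 q"
  "Q3 (p * q) = Q0 p * Q3 q + Q1 p * Q2 q - Q2 p * Q1 q + Q3 p * Q0 q"
  by (simp_all add: times_quat_def)

instantiation quat :: real_div_algebra
begin

definition scaleR_quat :: "real \<Rightarrow> quat \<Rightarrow> quat" where
  "scaleR_quat r p = Quat (r * Q0 p) (r * Q1 p) (r * Q2 p) (r * Q3 p)"

instance
  by standard (simp_all add: scaleR_quat_def quat_eq_iff quat_sel_times algebra_simps)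

end

lemma quat_sel_scaleR [simp]:
  "Q0 (r *\<^sub>R p) = r * Q0 p" "Q1 (r *\<^sub>R p) = r * Q1 p"
  "Q2 (r *\<^sub>R p) = r * Q2 p" "Q3 (r *\<^sub>R p) = r * Q3 p"
  by (simp_all add: scaleR_quat_def)

lemma quat_sel_of_real [simp]:
  "Q0 (of_real r) = r" "Q1 (of_real r) = 0" "Q2 (of_real r) = 0" "Q3 (of_real r) = 0"
  by (simp_all add: of_real_def)

instantiation quat :: real_inner
begin

definition inner_quat :: "quat \<Rightarrow> quat \<Rightarrow> real" where
  "inner_quat p q = Q0 p * Q0 q + Q1 p * Q1 q + Q2 p * Q2 q + Q3 p * Q3 q"

definition norm_quat :: "quat \<Rightarrow> real" where
  "norm_quat p = sqrt ((Q0 p)\<^sup>2 + (Q1 p)\<^sup>2 + (Q2 p)\<^sup>2 + (Q3 p)\<^sup>2)"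

definition sgn_quat :: "quat \<Rightarrow> quat" where
  "sgn_quat p = p /\<^sub>R norm p"

definition dist_quat :: "quat \<Rightarrow> quat \<Rightarrow> real" where
  "dist_quat p q = norm (p - q)"

definition uniformity_quat :: "(quat \<times> quat) filter" where
  "uniformity_quat = (INF e\<in>{0 <..}. principal {(p, q). dist p q < e})"

definition open_quat :: "quat set \<Rightarrow> bool" where
  "open_quat U \<longleftrightarrow> (\<forall>p\<in>U. eventually (\<lambda>(p', q). p' = p \<longrightarrow> q \<in> U) uniformity)"

instance
proof
  fix p q s :: quat and r :: real and U :: "quat set"
  show "dist p q = norm (p - q)" by (rule dist_quat_def)
  show "sgn p = p /\<^sub>R norm p" by (rule sgn_quat_def)
  show "uniformity = (INF e\<in>{0 <..}. principal {(p :: quat, q). dist p q < e})"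
    by (rule uniformity_quat_def)
  show "open U \<longleftrightarrow> (\<forall>p\<in>U. eventually (\<lambda>(p', q). p' = p \<longrightarrow> q \<in> U) uniformity)"
    by (rule open_quat_def)
  show "inner p q = inner q p"
    by (simp add: inner_quat_def mult.commute)
  show "inner (p + q) s = inner p s + inner q s"
    by (simp add: inner_quat_def algebra_simps)
  show "inner (r *\<^sub>R p) q = r * inner p q"
    by (simp add: inner_quat_def algebra_simps)
  show "0 \<le> inner p p"
    by (simp add: inner_quat_def)
  show "inner p p = 0 \<longleftrightarrow> p = 0"
    using quat_normsq_eq_0 [of p] by (simp add: inner_quat_def power2_eq_square)
  show "norm p = sqrt (inner p p)"
    by (simp add: inner_quat_def norm_quat_def power2_eq_square)
qed

end

lemma euler_four_squares:
  fixes a b c d x y z w :: real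
  shows "(a * x - b * y - c * z - d * w)\<^sup>2 + (a * y + b * x + c * w - d * z)\<^sup>2 +
         (a * z - b * w + c * x + d * y)\<^sup>2 + (a * w + b * z - c * y + d * x)\<^sup>2 =
         (a\<^sup>2 + b\<^sup>2 + c\<^sup>2 + d\<^sup>2) * (x\<^sup>2 + y\<^sup>2 + z\<^sup>2 + w\<^sup>2)"
  by (simp only: power2_eq_square ring_distribs, simp only: algebra_simps)

instance quat :: real_normed_div_algebra
proof
  fix p q :: quat
  show "norm (p * q) = norm p * norm q"
    unfolding norm_quat_def real_sqrt_mult [symmetric]
    by (simp only: quat_sel_times euler_four_squares)
qed

definition quat_i :: quat where "quat_i = Quat 0 1 0 0"
definition quat_j :: quat where "quat_j = Quat 0 0 1 0"
definition quat_k :: quat where "quat_k = Quat 0 0 0 1"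

instantiation quat :: euclidean_space
begin

definition Basis_quat :: "quat set" where "Basis_quat = {1, quat_i, quat_j, quat_k}"

instance
proof
  show "(Basis :: quat set) \<noteq> {}" and "finite (Basis :: quat set)"
    by (simp_all add: Basis_quat_def)
  show "inner u v = (if u = v then 1 else 0)" if "u \<in> Basis" "v \<in> Basis" for u v :: quat
    using that unfolding Basis_quat_def
    by (elim insertE emptyE; hypsubst)
       (simp_all add: inner_quat_def one_quat_def quat_i_def quat_j_def quat_k_def)
  show "(\<forall>u\<in>Basis. inner q u = 0) \<longleftrightarrow> q = 0" for q :: quat
    by (simp add: Basis_quat_def inner_quat_def quat_eq_iff [of q 0] quat_i_def quat_j_def quat_k_def)
qed

end


section \<open>Slice regular functions\<close>

definition Im_quat :: "quat set" where
  "Im_quat = span {quat_i, quat_j, quat_k}"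

definition proj_Im_quat :: "quat set set" where
  "proj_Im_quat = {span {v} |v. v \<in> Im_quat \<and> v \<noteq> 0}"

definition imag_units :: "quat set" where
  "imag_units = {q. q\<^sup>2 = -1}"

definition slice_plane :: "quat \<Rightarrow> quat set" where
  "slice_plane J = span {1, J}"

definition symmetric_slice_domain :: "quat set \<Rightarrow> bool" where
  "symmetric_slice_domain \<Omega> \<longleftrightarrow>
     open \<Omega> \<and> connected \<Omega> \<and> \<Omega> \<inter> \<real> \<noteq> {} \<and>
     (\<forall>a b. \<forall>I\<in>imag_units. \<forall>J\<in>imag_units.
        of_real a + I * of_real b \<in> \<Omega> \<longrightarrow> of_real a + J * of_real b \<in> \<Omega>)"

text \<open>Functions on \<open>\<Omega>\<close> are total functions whose values outside \<open>\<Omega>\<close> are ignored.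
  In the next definition, \<open>D (1, 0)\<close> and \<open>D (0, 1)\<close> are the two partial derivatives of
  \<open>(\<alpha>, \<beta>) \<mapsto> f (\<alpha> + J\<beta>)\<close>.\<close>

definition slice_regular :: "quat set \<Rightarrow> (quat \<Rightarrow> quat) \<Rightarrow> bool" where
  "slice_regular \<Omega> f \<longleftrightarrow>
     (\<forall>J\<in>imag_units. \<forall>a b. of_real a + J * of_real b \<in> \<Omega> \<longrightarrow>
        (\<exists>D. ((\<lambda>(x, y). f (of_real x + J * of_real y)) has_derivative D) (at (a, b)) \<and>
             (1 / 2) *\<^sub>R (D (1, 0) + J * D (0, 1)) = 0))"

definition slice_preserving :: "quat set \<Rightarrow> (quat \<Rightarrow> quat) \<Rightarrow> bool" where
  "slice_preserving \<Omega> f \<longleftrightarrow> slice_regular \<Omega> f \<and>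
     (\<forall>I\<in>imag_units. f ` (\<Omega> \<inter> slice_plane I) \<subseteq> slice_plane I)"

definition one_slice_preserving :: "quat set \<Rightarrow> (quat \<Rightarrow> quat) \<Rightarrow> bool" where
  "one_slice_preserving \<Omega> f \<longleftrightarrow> slice_regular \<Omega> f \<and>
     (\<exists>J\<in>imag_units. f ` (\<Omega> \<inter> slice_plane J) \<subseteq> slice_plane J)"

definition slice_decomposition ::
  "quat set \<Rightarrow> (quat \<Rightarrow> quat) \<Rightarrow>
   (quat \<Rightarrow> quat) \<times> (quat \<Rightarrow> quat) \<times> (quat \<Rightarrow> quat) \<times> (quat \<Rightarrow> quat) \<Rightarrow> bool" where
  "slice_decomposition \<Omega> f = (\<lambda>(f0, f1, f2, f3).
     slice_preserving \<Omega> f0 \<and> slice_preserving \<Omega> f1 \<and>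
     slice_preserving \<Omega> f2 \<and> slice_preserving \<Omega> f3 \<and>
     (\<forall>q\<in>\<Omega>. f q = f0 q + f1 q * quat_i + f2 q * quat_j + f3 q * quat_k))"

text \<open>For a slice regular function on a symmetric slice domain the decomposition exists and its
  components are unique on \<open>\<Omega>\<close>; they are arbitrary outside \<open>\<Omega>\<close>, hence a choice operator.\<close>

definition slice_components ::
  "quat set \<Rightarrow> (quat \<Rightarrow> quat) \<Rightarrow>
   (quat \<Rightarrow> quat) \<times> (quat \<Rightarrow> quat) \<times> (quat \<Rightarrow> quat) \<times> (quat \<Rightarrow> quat)" where
  "slice_components \<Omega> f = (SOME F. slice_decomposition \<Omega> f F)"

definition vectorial_part :: "quat set \<Rightarrow> (quat \<Rightarrow> quat) \<Rightarrow> quat \<Rightarrow> quat" where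
  "vectorial_part \<Omega> f = (case slice_components \<Omega> f of (f0, f1, f2, f3) \<Rightarrow>
     (\<lambda>q. f1 q * quat_i + f2 q * quat_j + f3 q * quat_k))"

definition symmetrized_vectorial_part :: "quat set \<Rightarrow> (quat \<Rightarrow> quat) \<Rightarrow> quat \<Rightarrow> quat" where
  "symmetrized_vectorial_part \<Omega> f = (case slice_components \<Omega> f of (f0, f1, f2, f3) \<Rightarrow>
     (\<lambda>q. (f1 q)\<^sup>2 + (f2 q)\<^sup>2 + (f3 q)\<^sup>2))"

definition is_square_root :: "quat set \<Rightarrow> (quat \<Rightarrow> quat) \<Rightarrow> (quat \<Rightarrow> quat) \<Rightarrow> bool" where
  "is_square_root \<Omega> \<mu> \<sigma> \<longleftrightarrow> slice_preserving \<Omega> \<sigma> \<and> (\<forall>q\<in>\<Omega>. (\<sigma> q)\<^sup>2 = \<mu> q)"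

text \<open>The quotient of a slice regular function \<open>g\<close> by a slice preserving function
  \<open>\<sigma>\<close>: its components are the quotients of the components of \<open>g\<close> by \<open>\<sigma>\<close>, so the
  inverse of \<open>\<sigma> q\<close> multiplies on the left of \<open>g q\<close> (the values need not commute).\<close>

definition slice_quotient :: "(quat \<Rightarrow> quat) \<Rightarrow> (quat \<Rightarrow> quat) \<Rightarrow> quat \<Rightarrow> quat" where
  "slice_quotient g \<sigma> = (\<lambda>q. inverse (\<sigma> q) * g q)"

end

theory Submission
  imports Defs "HOL-Complex_Analysis.Conformal_Mappings"
begin

text \<open>
  On each plane \<open>\<complex>\<^sub>J\<close> a slice regular function is holomorphic for left multiplication by \<open>J\<close>, so
  composing it with the complex linear functionals \<open>q \<mapsto> \<langle>q, p\<rangle> - \<i> \<langle>J q, p\<rangle>\<close> and applying the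
  identity theorem shows that it is determined by its values at real points. The decomposition
  \<open>f = f\<^sub>0 + f\<^sub>1 i + f\<^sub>2 j + f\<^sub>3 k\<close> exists because the two complex components of \<open>f\<close> on \<open>\<complex>\<^sub>i\<close> split into
  functions \<open>H\<close> with \<open>H (cnj z) = cnj (H z)\<close>, each of which extends to a slice preserving function.
  At real points all \<open>f\<^sub>n\<close> are real, and there both (i) and (ii) immediately give (iii). Conversely,
  if \<open>f\<^sub>v\<close> has constant direction \<open>v\<close>, \<open>|v| = 1\<close>, at real points and \<open>t = v\<^sub>1 f\<^sub>1 + v\<^sub>2 f\<^sub>2 + v\<^sub>3 f\<^sub>3\<close>, then
  \<open>f\<^sub>n = v\<^sub>n t\<close> at real points and therefore everywhere, so \<open>f = f\<^sub>0 + t v\<close> preserves \<open>\<complex>\<^sub>v\<close>, and \<open>t\<close> is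
  a square root of \<open>f\<^sub>v\<^sup>s\<close> with \<open>f\<^sub>v / t = v\<close>.
\<close>

section \<open>Imaginary units and slices\<close>

lemma quat_sel_basis [simp]:
  "Q0 quat_i = 0" "Q1 quat_i = 1" "Q2 quat_i = 0" "Q3 quat_i = 0"
  "Q0 quat_j = 0" "Q1 quat_j = 0" "Q2 quat_j = 1" "Q3 quat_j = 0"
  "Q0 quat_k = 0" "Q1 quat_k = 0" "Q2 quat_k = 0" "Q3 quat_k = 1"
  by (simp_all add: quat_i_def quat_j_def quat_k_def)

lemma span_scaleR_singleton:
  fixes v :: "'a :: real_vector"
  assumes "c \<noteq> 0"
  shows "span {c *\<^sub>R v} = span {v}"
  using span_image_scale [of "{v}" "\<lambda>_. c"] assms by simp

text \<open>The imaginary coordinates of \<open>q * q\<close> are those of \<open>q\<close> scaled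
  by \<open>2 * Q0 q\<close>. A nonzero real part would therefore make \<open>q\<close> real, and -1
  is not a real square.\<close>

lemma imag_units_iff:
  "q \<in> imag_units \<longleftrightarrow> Q0 q = 0 \<and> (Q1 q)\<^sup>2 + (Q2 q)\<^sup>2 + (Q3 q)\<^sup>2 = 1"
proof
  assume "q \<in> imag_units"
  then have q: "q * q = -1"
    by (simp add: imag_units_def power2_eq_square)
  have e: "Q0 q * Q0 q - Q1 q * Q1 q - Q2 q * Q2 q - Q3 q * Q3 q = -1"
    "Q0 q * Q1 q = 0" "Q0 q * Q2 q = 0" "Q0 q * Q3 q = 0"
    using q by (simp_all add: quat_eq_iff quat_sel_times)
  have "Q0 q = 0"
  proof (rule ccontr)
    assume "Q0 q \<noteq> 0"
    then have "Q0 q * Q0 q = -1"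
      using e by simp
    then show False
      using zero_le_square [of "Q0 q"] by linarith
  qed
  then show "Q0 q = 0 \<and> (Q1 q)\<^sup>2 + (Q2 q)\<^sup>2 + (Q3 q)\<^sup>2 = 1"
    using e by (simp add: power2_eq_square)
next
  assume "Q0 q = 0 \<and> (Q1 q)\<^sup>2 + (Q2 q)\<^sup>2 + (Q3 q)\<^sup>2 = 1"
  then show "q \<in> imag_units"
    by (simp add: imag_units_def power2_eq_square quat_eq_iff quat_sel_times)
qed

lemma imag_units_square: "J * J = -1" if "J \<in> imag_units"
  using that by (simp add: imag_units_def power2_eq_square)

lemma imag_units_square_left: "J * (J * q) = - q" if "J \<in> imag_units"
  using that by (simp add: imag_units_square flip: mult.assoc)

lemma norm_imag_units: "norm J = 1" if "J \<in> imag_units"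
  using that by (simp add: imag_units_iff norm_quat_def)

lemma uminus_in_imag_units: "- J \<in> imag_units" if "J \<in> imag_units"
  using that by (simp add: imag_units_iff)

lemma quat_basis_in_imag_units:
  "quat_i \<in> imag_units" "quat_j \<in> imag_units" "quat_k \<in> imag_units"
  by (simp_all add: imag_units_iff)

lemma Im_quat_iff: "q \<in> Im_quat \<longleftrightarrow> Q0 q = 0"
proof
  assume "q \<in> Im_quat"
  then show "Q0 q = 0"
    unfolding Im_quat_def by (induction rule: span_induct_alt) auto
next
  assume "Q0 q = 0"
  then have "q = Q1 q *\<^sub>R quat_i + Q2 q *\<^sub>R quat_j + Q3 q *\<^sub>R quat_k"
    by (simp add: quat_eq_iff)
  also have "\<dots> \<in> Im_quat"
    unfolding Im_quat_def by (intro span_add span_scale span_base) auto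
  finally show "q \<in> Im_quat" .
qed

text \<open>For an imaginary unit \<open>J\<close> this is the ring isomorphism from the complex
  numbers onto \<open>slice_plane J\<close>. It transports questions on a slice to complex
  analysis.\<close>

definition slice_point :: "quat \<Rightarrow> complex \<Rightarrow> quat" where
  "slice_point J z = of_real (Re z) + J * of_real (Im z)"

lemma slice_point_eq: "slice_point J z = Re z *\<^sub>R 1 + Im z *\<^sub>R J"
  by (simp add: slice_point_def of_real_def)

lemma slice_point_of_real [simp]: "slice_point J (of_real x) = of_real x"
  by (simp add: slice_point_def)

lemma slice_point_cnj: "slice_point J (cnj z) = slice_point (- J) z"
  by (simp add: slice_point_eq)

lemma bounded_linear_slice_point: "bounded_linear (slice_point J)"
  unfolding slice_point_eq
  by (intro bounded_linear_add bounded_linear_scaleR_const bounded_linear_Re bounded_linear_Im)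

lemma slice_plane_eq: "slice_plane J = range (slice_point J)"
proof (intro set_eqI iffI)
  fix q assume "q \<in> slice_plane J"
  then obtain a b where "q - a *\<^sub>R 1 = b *\<^sub>R J"
    by (auto simp: slice_plane_def span_breakdown_eq span_singleton)
  then have "q = slice_point J (Complex a b)"
    by (simp add: slice_point_eq algebra_simps)
  then show "q \<in> range (slice_point J)"
    by blast
next
  fix q assume "q \<in> range (slice_point J)"
  then show "q \<in> slice_plane J"
    unfolding slice_plane_def slice_point_eq
    by (auto intro!: span_add span_scale intro: span_base)
qed

lemma slice_plane_mult: "p * q \<in> slice_plane J"
  if J: "J \<in> imag_units" and pq: "p \<in> slice_plane J" "q \<in> slice_plane J"
proof -
  obtain z w where "p = slice_point J z" "q = slice_point J w"
    using pq by (auto simp: slice_plane_eq)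
  then have "p * q = slice_point J (z * w)"
    using imag_units_square [OF J] by (simp add: slice_point_eq algebra_simps)
  then show ?thesis
    by (simp add: slice_plane_eq)
qed

text \<open>Take \<open>J\<close> to be the normalized imaginary part of \<open>q\<close>, or any
  unit when \<open>q\<close> is real. The complex coordinate is spelled out because it depends
  continuously on \<open>q\<close>, even where \<open>J\<close> does not.\<close>

lemma exists_slice_point:
  obtains J where "J \<in> imag_units"
    "q = slice_point J (Complex (Q0 q) (norm (q - of_real (Q0 q))))"
proof (cases "q = of_real (Q0 q)")
  case True
  then show thesis
    using that [OF quat_basis_in_imag_units(1)] by (metis Complex_eq complex_of_real_def diff_self
        norm_zero slice_point_of_real)
next
  case False
  define v where "v = q - of_real (Q0 q)"
  have v: "v \<noteq> 0" "Q0 v = 0"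
    using False by (auto simp: v_def)
  have "(Q1 v)\<^sup>2 + (Q2 v)\<^sup>2 + (Q3 v)\<^sup>2 = (norm v)\<^sup>2"
    using v by (simp add: norm_quat_def)
  then have "(inverse (norm v) * Q1 v)\<^sup>2 + (inverse (norm v) * Q2 v)\<^sup>2 + (inverse (norm v) * Q3 v)\<^sup>2 = 1"
    using v by (simp add: power_mult_distrib power_inverse flip: distrib_left)
  then have "inverse (norm v) *\<^sub>R v \<in> imag_units"
    using v by (simp add: imag_units_iff)
  moreover have "q = slice_point (inverse (norm v) *\<^sub>R v) (Complex (Q0 q) (norm v))"
    using v by (simp add: slice_point_eq) (simp add: v_def of_real_def)
  ultimately show thesis
    using that by (simp add: v_def)
qed

lemma symmetric_slice_domain_slice_point:
  assumes "symmetric_slice_domain \<Omega>" "I \<in> imag_units" "J \<in> imag_units" "slice_point I z \<in> \<Omega>"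
  shows "slice_point J z \<in> \<Omega>"
  using assms unfolding symmetric_slice_domain_def slice_point_def by blast

text \<open>The choice of \<open>quat_i\<close> is arbitrary: by symmetry of the domain every
  imaginary unit gives the same planar set.\<close>

definition slice_preimage :: "quat set \<Rightarrow> complex set" where
  "slice_preimage \<Omega> = slice_point quat_i -` \<Omega>"

lemma slice_point_in_iff:
  assumes "symmetric_slice_domain \<Omega>" "J \<in> imag_units"
  shows "slice_point J z \<in> \<Omega> \<longleftrightarrow> z \<in> slice_preimage \<Omega>"
  using symmetric_slice_domain_slice_point [OF assms(1)] assms(2) quat_basis_in_imag_units(1)
  unfolding slice_preimage_def by blast

lemma of_real_in_slice_preimage [simp]: "complex_of_real x \<in> slice_preimage \<Omega> \<longleftrightarrow> of_real x \<in> \<Omega>"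
  by (simp add: slice_preimage_def)

lemma cnj_in_slice_preimage:
  assumes "symmetric_slice_domain \<Omega>" "z \<in> slice_preimage \<Omega>"
  shows "cnj z \<in> slice_preimage \<Omega>"
  using assms slice_point_in_iff [OF assms(1)] quat_basis_in_imag_units(1) uminus_in_imag_units
  by (metis slice_point_cnj)

lemma open_slice_preimage:
  assumes "symmetric_slice_domain \<Omega>"
  shows "open (slice_preimage \<Omega>)"
  using assms unfolding slice_preimage_def symmetric_slice_domain_def
  by (intro open_vimage linear_continuous_on bounded_linear_slice_point) auto

text \<open>The continuous map \<open>h\<close> folds the domain onto the part of the planar set in
  the closed upper half plane. That part and its conjugate are connected, cover the planar set, and
  share a real point.\<close>

lemma connected_slice_preimage:
  assumes \<Omega>: "symmetric_slice_domain \<Omega>"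
  shows "connected (slice_preimage \<Omega>)"
proof -
  define h where "h q = Complex (Q0 q) (norm (q - of_real (Q0 q)))" for q
  have Q0: "Q0 = (\<lambda>q. inner q 1)"
    by (simp add: inner_quat_def fun_eq_iff)
  have "continuous_on \<Omega> h"
    unfolding h_def Complex_eq Q0 by (intro continuous_intros)
  then have conn: "connected (h ` \<Omega>)"
    using \<Omega> by (auto simp: symmetric_slice_domain_def intro: connected_continuous_image)
  then have conn': "connected (cnj ` h ` \<Omega>)"
    by (rule connected_continuous_image [rotated]) (intro continuous_intros)
  have h_in: "h q \<in> slice_preimage \<Omega>" if "q \<in> \<Omega>" for q
  proof -
    obtain J where "J \<in> imag_units" "q = slice_point J (h q)"
      using exists_slice_point unfolding h_def by blast
    then show ?thesis
      using that slice_point_in_iff [OF \<Omega>] by metis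
  qed
  have h_slice: "h (slice_point quat_i z) = Complex (Re z) \<bar>Im z\<bar>" for z
    by (simp add: h_def slice_point_def norm_mult norm_imag_units quat_basis_in_imag_units
        quat_sel_times)
  have "slice_preimage \<Omega> = h ` \<Omega> \<union> cnj ` h ` \<Omega>"
  proof (intro equalityI subsetI)
    fix z assume z: "z \<in> slice_preimage \<Omega>"
    have "z = h (slice_point quat_i z) \<or> z = cnj (h (slice_point quat_i z))"
      unfolding h_slice by (auto simp: complex_eq_iff abs_if)
    then show "z \<in> h ` \<Omega> \<union> cnj ` h ` \<Omega>"
      using z by (auto simp: slice_preimage_def)
  next
    fix z assume "z \<in> h ` \<Omega> \<union> cnj ` h ` \<Omega>"
    then show "z \<in> slice_preimage \<Omega>"
      using h_in cnj_in_slice_preimage [OF \<Omega>] by auto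
  qed
  moreover obtain x where "of_real x \<in> \<Omega>"
    using \<Omega> by (auto simp: symmetric_slice_domain_def Reals_def)
  moreover have "cnj (h (of_real x)) = h (of_real x)"
    by (simp add: h_def complex_eq_iff)
  ultimately show ?thesis
    using connected_Un [OF conn conn'] by (metis IntI empty_iff image_eqI)
qed

section \<open>The identity principle\<close>

text \<open>Multiplying the Cauchy-Riemann equation by \<open>J\<close> on the left solves it for
  the derivative in the imaginary direction. In this form it says that the derivative is complex
  linear when \<i> acts on quaternions as left multiplication by \<open>J\<close>.\<close>

lemma slice_regular_iff:
  "slice_regular \<Omega> f \<longleftrightarrow>
     (\<forall>J\<in>imag_units. \<forall>z. slice_point J z \<in> \<Omega> \<longrightarrow>
        (\<exists>D. ((\<lambda>z. f (slice_point J z)) has_derivative D) (at z) \<and> D \<i> = J * D 1))"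
proof -
  have eq: "(\<exists>D. ((\<lambda>(x, y). f (of_real x + J * of_real y)) has_derivative D) (at (a, b)) \<and>
             (1 / 2) *\<^sub>R (D (1, 0) + J * D (0, 1)) = 0) \<longleftrightarrow>
        (\<exists>D. ((\<lambda>z. f (slice_point J z)) has_derivative D) (at (Complex a b)) \<and> D \<i> = J * D 1)"
    (is "(\<exists>D. ?P D) \<longleftrightarrow> (\<exists>D. ?Q D)") if J: "J \<in> imag_units" for J a b
  proof
    assume "\<exists>D. ?P D"
    then obtain D where D: "((\<lambda>(x, y). f (of_real x + J * of_real y)) has_derivative D) (at (a, b))"
      and "D (1, 0) + J * D (0, 1) = 0"
      by auto
    then have "J * D (1, 0) = J * (- (J * D (0, 1)))"
      by (simp add: add_eq_0_iff2)
    then have CR: "D (0, 1) = J * D (1, 0)"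
      by (simp add: imag_units_square_left [OF J])
    have "((\<lambda>z. (Re z, Im z)) has_derivative (\<lambda>z. (Re z, Im z))) (at (Complex a b))"
      by (intro derivative_eq_intros) auto
    then have "((\<lambda>z. (\<lambda>(x, y). f (of_real x + J * of_real y)) (Re z, Im z))
        has_derivative (\<lambda>z. D (Re z, Im z))) (at (Complex a b))"
      by (rule has_derivative_compose) (use D in simp)
    then show "\<exists>D. ?Q D"
      by (intro exI [of _ "\<lambda>z. D (Re z, Im z)"]) (simp add: slice_point_def CR)
  next
    assume "\<exists>D. ?Q D"
    then obtain D where D: "((\<lambda>z. f (slice_point J z)) has_derivative D) (at (Complex a b))"
      and CR: "D \<i> = J * D 1"
      by auto
    have "((\<lambda>p. Complex (fst p) (snd p)) has_derivative (\<lambda>p. Complex (fst p) (snd p))) (at (a, b))"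
      unfolding Complex_eq by (auto intro!: derivative_eq_intros)
    then have "((\<lambda>p. f (slice_point J (Complex (fst p) (snd p))))
        has_derivative (\<lambda>p. D (Complex (fst p) (snd p)))) (at (a, b))"
      by (rule has_derivative_compose) (use D in simp)
    then show "\<exists>D. ?P D"
      using CR imag_units_square_left [OF J]
      by (intro exI [of _ "\<lambda>p. D (Complex (fst p) (snd p))"])
        (simp add: slice_point_def case_prod_beta' flip: one_complex.code imaginary_unit.code)
  qed
  have point: "of_real a + J * of_real b = slice_point J (Complex a b)" for a b J
    by (simp add: slice_point_def)
  have all_complex: "(\<forall>z. P z) \<longleftrightarrow> (\<forall>a b. P (Complex a b))" for P
    by (metis complex.collapse)
  show ?thesis
    unfolding slice_regular_def all_complex point [symmetric]
    by (intro ball_cong refl) (simp only: eq)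
qed

lemma slice_regularI:
  assumes "\<And>J z. J \<in> imag_units \<Longrightarrow> slice_point J z \<in> \<Omega> \<Longrightarrow>
    \<exists>D. ((\<lambda>z. f (slice_point J z)) has_derivative D) (at z) \<and> D \<i> = J * D 1"
  shows "slice_regular \<Omega> f"
  using assms by (auto simp: slice_regular_iff)

lemma slice_regularE:
  assumes "slice_regular \<Omega> f" "J \<in> imag_units" "slice_point J z \<in> \<Omega>"
  obtains D where "((\<lambda>z. f (slice_point J z)) has_derivative D) (at z)" "D \<i> = J * D 1"
  using assms unfolding slice_regular_iff by blast

lemma slice_regular_add:
  assumes "slice_regular \<Omega> f" "slice_regular \<Omega> g"
  shows "slice_regular \<Omega> (\<lambda>q. f q + g q)"
proof (rule slice_regularI)
  fix J z assume J: "J \<in> imag_units" "slice_point J z \<in> \<Omega>"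
  obtain D where D: "((\<lambda>z. f (slice_point J z)) has_derivative D) (at z)" "D \<i> = J * D 1"
    using slice_regularE [OF assms(1) J] .
  obtain E where E: "((\<lambda>z. g (slice_point J z)) has_derivative E) (at z)" "E \<i> = J * E 1"
    using slice_regularE [OF assms(2) J] .
  show "\<exists>D. ((\<lambda>z. f (slice_point J z) + g (slice_point J z)) has_derivative D) (at z) \<and> D \<i> = J * D 1"
    by (rule exI, rule conjI, rule has_derivative_add [OF D(1) E(1)])
      (simp add: D E distrib_left)
qed

text \<open>By associativity, right multiplication by \<open>c\<close> commutes with left
  multiplication by \<open>J\<close>. This is why the constants in the decomposition stand on the
  right.\<close>

lemma slice_regular_mult_right:
  assumes "slice_regular \<Omega> f"
  shows "slice_regular \<Omega> (\<lambda>q. f q * c)"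
proof (rule slice_regularI)
  fix J z assume J: "J \<in> imag_units" "slice_point J z \<in> \<Omega>"
  obtain D where D: "((\<lambda>z. f (slice_point J z)) has_derivative D) (at z)" "D \<i> = J * D 1"
    using slice_regularE [OF assms(1) J] .
  show "\<exists>D. ((\<lambda>z. f (slice_point J z) * c) has_derivative D) (at z) \<and> D \<i> = J * D 1"
    by (rule exI, rule conjI, rule has_derivative_mult_left [OF D(1)])
      (simp add: D mult.assoc)
qed

lemma slice_regular_scaleR:
  assumes "slice_regular \<Omega> f"
  shows "slice_regular \<Omega> (\<lambda>q. c *\<^sub>R f q)"
  using slice_regular_mult_right [OF assms, of "of_real c"] by (simp add: of_real_def)

lemma slice_regular_diff:
  assumes "slice_regular \<Omega> f" "slice_regular \<Omega> g"
  shows "slice_regular \<Omega> (\<lambda>q. f q - g q)"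
  using slice_regular_add [OF assms(1) slice_regular_scaleR [OF assms(2), of "-1"]] by simp

text \<open>Complex linear for the complex structure on the quaternions given by left multiplication
  by \<open>J\<close>.\<close>

definition slice_functional :: "quat \<Rightarrow> quat \<Rightarrow> quat \<Rightarrow> complex" where
  "slice_functional J p q = Complex (inner q p) (- inner (J * q) p)"

text \<open>The minus sign in the imaginary part of the functional makes left multiplication by
  \<open>J\<close> correspond to \<i> and not to its conjugate.\<close>

lemma slice_functional_mult:
  assumes "J \<in> imag_units"
  shows "slice_functional J p (J * q) = \<i> * slice_functional J p q"
  by (simp add: slice_functional_def complex_eq_iff imag_units_square_left [OF assms])

lemma bounded_linear_slice_functional: "bounded_linear (slice_functional J p)"
proof -
  have "bounded_linear (\<lambda>q. of_real (inner q p) - \<i> * of_real (inner (J * q) p) :: complex)"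
    by (intro bounded_linear_sub bounded_linear_const_mult
        bounded_linear_compose [OF bounded_linear_of_real]
        bounded_linear_compose [OF bounded_linear_inner_left bounded_linear_mult_right]
        bounded_linear_inner_left)
  then show ?thesis
    by (simp add: slice_functional_def [abs_def] Complex_eq)
qed

text \<open>Both the derivative of \<open>f\<close> along the slice and the functional are complex
  linear, so their composition is multiplication by its value at 1.\<close>

lemma slice_functional_holomorphic_on:
  assumes \<Omega>: "symmetric_slice_domain \<Omega>" and f: "slice_regular \<Omega> f" and J: "J \<in> imag_units"
  shows "(\<lambda>z. slice_functional J p (f (slice_point J z))) holomorphic_on slice_preimage \<Omega>"
proof -
  have "\<exists>c. ((\<lambda>z. slice_functional J p (f (slice_point J z))) has_field_derivative c) (at z)"
    if z: "z \<in> slice_preimage \<Omega>" for z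
  proof -
    have "slice_point J z \<in> \<Omega>"
      using z slice_point_in_iff [OF \<Omega> J] by simp
    then obtain D where D: "((\<lambda>z. f (slice_point J z)) has_derivative D) (at z)"
      and CR: "D \<i> = J * D 1"
      using slice_regularE [OF f J] by blast
    interpret D: linear D
      using D by (rule has_derivative_linear)
    interpret \<phi>: bounded_linear "slice_functional J p"
      by (rule bounded_linear_slice_functional)
    have "slice_functional J p (D w) = slice_functional J p (D 1) * w" for w
    proof -
      have "w = Re w *\<^sub>R 1 + Im w *\<^sub>R \<i>"
        by (simp add: complex_eq_iff)
      then have "D w = Re w *\<^sub>R D 1 + Im w *\<^sub>R (J * D 1)"
        by (metis CR D.add D.scale)
      then show ?thesis
        by (simp add: \<phi>.add \<phi>.scale slice_functional_mult [OF J] complex_eq_iff)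
    qed
    then have "(\<lambda>w. slice_functional J p (D w)) = (*) (slice_functional J p (D 1))"
      by (rule ext)
    then show ?thesis
      using \<phi>.has_derivative [OF D] by (auto simp: has_field_derivative_def)
  qed
  then show ?thesis
    using open_slice_preimage [OF \<Omega>] by (auto simp: holomorphic_on_open)
qed

text \<open>The difference is tested against its own value \<open>d\<close> at \<open>q\<close>. The
  resulting holomorphic function vanishes on the real points of a connected open set, hence also at
  the coordinate of \<open>q\<close>.\<close>

theorem slice_regular_identity_principle:
  assumes \<Omega>: "symmetric_slice_domain \<Omega>"
    and f: "slice_regular \<Omega> f" and g: "slice_regular \<Omega> g"
    and eq: "\<And>x. of_real x \<in> \<Omega> \<Longrightarrow> f (of_real x) = g (of_real x)"
    and q: "q \<in> \<Omega>"
  shows "f q = g q"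
proof -
  obtain J w where J: "J \<in> imag_units" and w: "q = slice_point J w"
    using exists_slice_point by blast
  define d where "d = f q - g q"
  define G where "G z = slice_functional J d (f (slice_point J z) - g (slice_point J z))" for z
  let ?D = "slice_preimage \<Omega>"
  obtain x where x: "of_real x \<in> \<Omega>"
    using \<Omega> by (auto simp: symmetric_slice_domain_def Reals_def)
  \<comment> \<open>The real points of the domain accumulate at \<open>x\<close>: moving by half of
    \<open>min e r\<close> stays within both radii.\<close>
  have limpt: "complex_of_real x islimpt (?D \<inter> \<real>)"
    unfolding islimpt_approachable
  proof (intro allI impI)
    fix e :: real assume "e > 0"
    obtain r where r: "r > 0" "ball (complex_of_real x) r \<subseteq> ?D"
      using open_slice_preimage [OF \<Omega>] x by (meson of_real_in_slice_preimage open_contains_ball)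
    define t where "t = min e r / 2"
    have t: "0 < t" "t < e" "t < r"
      using \<open>e > 0\<close> \<open>r > 0\<close> by (auto simp: t_def)
    have d: "dist (complex_of_real (x + t)) (of_real x) = t"
      using t by (simp add: dist_norm)
    then have "complex_of_real (x + t) \<in> ?D"
      using r t by (auto simp: subset_iff dist_commute)
    then show "\<exists>x'\<in>?D \<inter> \<real>. x' \<noteq> complex_of_real x \<and> dist x' (complex_of_real x) < e"
      using d t by (intro bexI [of _ "complex_of_real (x + t)"]) auto
  qed
  have "G w = 0"
  proof (rule analytic_continuation [where f = G, OF _ _ _ _ _ limpt])
    show "G holomorphic_on ?D"
      unfolding G_def
      using slice_functional_holomorphic_on [OF \<Omega> slice_regular_diff [OF f g] J] .
    show "G z = 0" if z: "z \<in> ?D \<inter> \<real>" for z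
    proof -
      obtain y where y: "z = of_real y"
        using z by (auto elim: Reals_cases)
      then show ?thesis
        using z eq [of y] by (simp add: y G_def slice_functional_def Complex_eq)
    qed
    show "w \<in> ?D"
      using q slice_point_in_iff [OF \<Omega> J] w by simp
  qed (simp_all add: x open_slice_preimage [OF \<Omega>] connected_slice_preimage [OF \<Omega>])
  \<comment> \<open>The real part of \<open>G w\<close> is \<open>inner d d\<close>, since the
    functional was taken in the direction \<open>d\<close>.\<close>
  then have "inner d d = 0"
    by (simp add: G_def slice_functional_def complex_eq_iff d_def w)
  then show ?thesis
    by (simp add: d_def)
qed

section \<open>Slice preserving functions and the decomposition\<close>

lemma slice_preserving_imp_slice_regular: "slice_preserving \<Omega> f \<Longrightarrow> slice_regular \<Omega> f"
  by (simp add: slice_preserving_def)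

lemma slice_preserving_in_slice_plane:
  assumes "slice_preserving \<Omega> f" "J \<in> imag_units" "q \<in> \<Omega>" "q \<in> slice_plane J"
  shows "f q \<in> slice_plane J"
  using assms unfolding slice_preserving_def by blast

lemma slice_preserving_add:
  assumes "slice_preserving \<Omega> f" "slice_preserving \<Omega> g"
  shows "slice_preserving \<Omega> (\<lambda>q. f q + g q)"
  using slice_regular_add [of \<Omega> f g] assms [THEN slice_preserving_imp_slice_regular]
    assms [THEN slice_preserving_in_slice_plane]
  unfolding slice_preserving_def slice_plane_def by (auto intro: span_add)

lemma slice_preserving_scaleR:
  assumes "slice_preserving \<Omega> f"
  shows "slice_preserving \<Omega> (\<lambda>q. c *\<^sub>R f q)"
  using slice_regular_scaleR [of \<Omega> f c] assms [THEN slice_preserving_imp_slice_regular]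
    assms [THEN slice_preserving_in_slice_plane]
  unfolding slice_preserving_def slice_plane_def by (auto intro: span_scale)

text \<open>A real point lies in every slice, so its value does too, and the planes of
  \<open>quat_i\<close> and \<open>quat_j\<close> meet only in the reals.\<close>

lemma slice_preserving_of_real:
  assumes "slice_preserving \<Omega> f" "of_real x \<in> \<Omega>"
  shows "f (of_real x) = of_real (Q0 (f (of_real x)))"
proof -
  have "f (of_real x) \<in> slice_plane J" if "J \<in> imag_units" for J
    using slice_preserving_in_slice_plane [OF assms(1) that assms(2)]
    by (metis rangeI slice_plane_eq slice_point_of_real)
  then obtain z w where "f (of_real x) = slice_point quat_i z" "f (of_real x) = slice_point quat_j w"
    using quat_basis_in_imag_units unfolding slice_plane_eq by blast
  then show ?thesis
    by (auto simp: quat_eq_iff slice_point_eq)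
qed

text \<open>At real points the unit vector degenerates to the junk value \<open>0\<close>; this is harmless if
  \<open>H (cnj z) = cnj (H z)\<close>, since \<open>H\<close> is then real on the real axis.\<close>

definition slice_extension :: "(complex \<Rightarrow> complex) \<Rightarrow> quat \<Rightarrow> quat" where
  "slice_extension H q =
     (let v = q - of_real (Q0 q)
      in slice_point (v /\<^sub>R norm v) (H (Complex (Q0 q) (norm v))))"

text \<open>The definition always uses the coordinate in the upper half plane. Below the axis this
  replaces \<open>J\<close> by \<open>-J\<close> and \<open>z\<close> by \<open>cnj z\<close>, which
  the symmetry of \<open>H\<close> compensates. On the axis \<open>H z\<close> is real, so the unit
  does not matter.\<close>

lemma slice_extension_slice_point:
  assumes J: "J \<in> imag_units" and H: "\<And>z. H (cnj z) = cnj (H z)"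
  shows "slice_extension H (slice_point J z) = slice_point J (H z)"
proof -
  have Q0: "Q0 (slice_point J z) = Re z"
    using J by (simp add: slice_point_eq imag_units_iff)
  have v: "slice_point J z - of_real (Re z) = Im z *\<^sub>R J"
    by (simp add: slice_point_eq of_real_def)
  have *: "slice_extension H (slice_point J z) =
      slice_point ((Im z / \<bar>Im z\<bar>) *\<^sub>R J) (H (Complex (Re z) \<bar>Im z\<bar>))"
    unfolding slice_extension_def Q0 v Let_def
    by (simp add: norm_imag_units [OF J] divide_inverse mult.commute)
  consider "Im z > 0" | "Im z = 0" | "Im z < 0"
    by linarith
  then show ?thesis
  proof cases
    case 1
    then show ?thesis
      by (simp add: *)
  next
    case 2
    then have "z = cnj z" "Complex (Re z) 0 = z"
      by (simp_all add: complex_eq_iff)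
    then have "Im (H z) = 0"
      using H [of z] by (metis Reals_cnj_iff complex_is_Real_iff)
    then show ?thesis
      unfolding * using \<open>Complex (Re z) 0 = z\<close> 2 by (simp add: slice_point_eq)
  next
    case 3
    then have "Complex (Re z) \<bar>Im z\<bar> = cnj z"
      by (simp add: complex_eq_iff)
    then show ?thesis
      unfolding * using 3 H by (simp add: slice_point_eq)
  qed
qed

text \<open>In slice coordinates the extension is \<open>H\<close> followed by
  \<open>slice_point J\<close>, which turns multiplication by \<i> into left multiplication by
  \<open>J\<close>.\<close>

lemma slice_preserving_slice_extension:
  assumes \<Omega>: "symmetric_slice_domain \<Omega>" and hol: "H holomorphic_on slice_preimage \<Omega>"
    and H: "\<And>z. H (cnj z) = cnj (H z)"
  shows "slice_preserving \<Omega> (slice_extension H)"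
proof -
  have "slice_regular \<Omega> (slice_extension H)"
  proof (rule slice_regularI)
    fix J z assume J: "J \<in> imag_units" and z: "slice_point J z \<in> \<Omega>"
    obtain c where "(H has_field_derivative c) (at z)"
      using hol z slice_point_in_iff [OF \<Omega> J] open_slice_preimage [OF \<Omega>]
      by (auto simp: holomorphic_on_open)
    then have "(H has_derivative (*) c) (at z)"
      by (simp add: has_field_derivative_def)
    then have "((\<lambda>z. slice_point J (H z)) has_derivative (\<lambda>w. slice_point J (c * w))) (at z)"
      by (rule bounded_linear.has_derivative [OF bounded_linear_slice_point])
    moreover have "slice_point J (c * \<i>) = J * slice_point J (c * 1)"
      using imag_units_square [OF J] by (simp add: slice_point_eq algebra_simps)
    ultimately show "\<exists>D. ((\<lambda>z. slice_extension H (slice_point J z)) has_derivative D) (at z) \<and>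
        D \<i> = J * D 1"
      unfolding slice_extension_slice_point [of J H, OF J H] by blast
  qed
  then show ?thesis
    unfolding slice_preserving_def
    by (auto simp: slice_plane_eq slice_extension_slice_point [of _ H, OF _ H])
qed

text \<open>These are the even and odd parts of \<open>G\<close> under the involution
  \<open>cnj \<circ> G \<circ> cnj\<close>. Dividing the odd part by \<i> makes it invariant as
  well.\<close>

lemma holomorphic_split_cnj:
  assumes \<Omega>: "symmetric_slice_domain \<Omega>" and G: "G holomorphic_on slice_preimage \<Omega>"
  obtains A B where
    "A holomorphic_on slice_preimage \<Omega>" "\<And>z. A (cnj z) = cnj (A z)"
    "B holomorphic_on slice_preimage \<Omega>" "\<And>z. B (cnj z) = cnj (B z)"
    "\<And>z. G z = A z + \<i> * B z"
proof
  let ?A = "\<lambda>z. (G z + (cnj \<circ> G \<circ> cnj) z) / 2"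
  let ?B = "\<lambda>z. (G z - (cnj \<circ> G \<circ> cnj) z) / (2 * \<i>)"
  have "cnj ` slice_preimage \<Omega> = slice_preimage \<Omega>"
    using cnj_in_slice_preimage [OF \<Omega>] by (force simp: image_iff)
  then have G': "(cnj \<circ> G \<circ> cnj) holomorphic_on slice_preimage \<Omega>"
    using G open_slice_preimage [OF \<Omega>] by (intro holomorphic_on_compose_cnj_cnj) auto
  show "?A holomorphic_on slice_preimage \<Omega>" "?B holomorphic_on slice_preimage \<Omega>"
    by (intro holomorphic_intros G G'; simp)+
  show "?A (cnj z) = cnj (?A z)" "?B (cnj z) = cnj (?B z)" "G z = ?A z + \<i> * ?B z" for z
    by (simp_all add: field_simps)
qed

text \<open>With \<open>J = quat_i\<close>, the functionals for 1 and \<open>quat_j\<close> read off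
  \<open>Q0 + \<i> Q1\<close> and \<open>Q2 + \<i> Q3\<close>. At real points the four symmetric
  functions are real, hence equal to the coordinates of \<open>f\<close> there. The identity
  principle then spreads the equality over the domain.\<close>

theorem slice_decomposition_exists:
  assumes \<Omega>: "symmetric_slice_domain \<Omega>" and f: "slice_regular \<Omega> f"
  shows "\<exists>F. slice_decomposition \<Omega> f F"
proof -
  note i = quat_basis_in_imag_units(1)
  note hol = slice_functional_holomorphic_on [OF \<Omega> f i]
  obtain H0 H1 where
    H0: "H0 holomorphic_on slice_preimage \<Omega>" "\<And>z. H0 (cnj z) = cnj (H0 z)" and
    H1: "H1 holomorphic_on slice_preimage \<Omega>" "\<And>z. H1 (cnj z) = cnj (H1 z)" and
    G1: "\<And>z. slice_functional quat_i 1 (f (slice_point quat_i z)) = H0 z + \<i> * H1 z"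
    using holomorphic_split_cnj [OF \<Omega> hol, of 1] by metis
  obtain H2 H3 where
    H2: "H2 holomorphic_on slice_preimage \<Omega>" "\<And>z. H2 (cnj z) = cnj (H2 z)" and
    H3: "H3 holomorphic_on slice_preimage \<Omega>" "\<And>z. H3 (cnj z) = cnj (H3 z)" and
    G2: "\<And>z. slice_functional quat_i quat_j (f (slice_point quat_i z)) = H2 z + \<i> * H3 z"
    using holomorphic_split_cnj [OF \<Omega> hol, of quat_j] by metis
  define g where "g q = slice_extension H0 q + slice_extension H1 q * quat_i +
    slice_extension H2 q * quat_j + slice_extension H3 q * quat_k" for q
  note ext = slice_preserving_slice_extension [OF \<Omega>]
  have g: "slice_regular \<Omega> g"
    unfolding g_def
    by (intro slice_regular_add slice_regular_mult_right slice_preserving_imp_slice_regular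
        ext H0 H1 H2 H3)
  have "f (of_real x) = g (of_real x)" for x
  proof -
    have ext_real: "slice_extension H (of_real x) = of_real (Re (H (of_real x)))"
      and im_real: "Im (H (of_real x)) = 0" if "\<And>z. H (cnj z) = cnj (H z)" for H
    proof -
      show "Im (H (of_real x)) = 0"
        using that [of "of_real x"] by (simp add: complex_eq_iff)
      then show "slice_extension H (of_real x) = of_real (Re (H (of_real x)))"
        using slice_extension_slice_point [of quat_i H "of_real x", OF i that]
        by (simp add: slice_point_def)
    qed
    show ?thesis
      using G1 [of "of_real x"] G2 [of "of_real x"]
      by (simp add: g_def ext_real im_real H0 H1 H2 H3 quat_eq_iff quat_sel_times
          slice_functional_def complex_eq_iff inner_quat_def)
  qed
  then have "f q = g q" if "q \<in> \<Omega>" for q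
    using slice_regular_identity_principle [OF \<Omega> f g _ that] by blast
  then have "slice_decomposition \<Omega> f
      (slice_extension H0, slice_extension H1, slice_extension H2, slice_extension H3)"
    by (simp add: slice_decomposition_def g_def ext H0 H1 H2 H3)
  then show ?thesis ..
qed

section \<open>Equivalence of the three conditions via the values at real points\<close>

theorem theorem2p3:
  fixes \<Omega> :: "quat set" and f :: "quat \<Rightarrow> quat"
  assumes "symmetric_slice_domain \<Omega>"
    and "slice_regular \<Omega> f"
    and "\<not> slice_preserving \<Omega> f"
  shows "(one_slice_preserving \<Omega> f \<longleftrightarrow>
            (\<exists>\<sigma>. is_square_root \<Omega> (symmetrized_vectorial_part \<Omega> f) \<sigma> \<and>
                 slice_quotient (vectorial_part \<Omega> f) \<sigma> constant_on
                   {q \<in> \<Omega>. symmetrized_vectorial_part \<Omega> f q \<noteq> 0}))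
       \<and> (one_slice_preserving \<Omega> f \<longleftrightarrow>
            (\<exists>L\<in>proj_Im_quat. \<forall>x\<in>\<Omega> \<inter> \<real>.
                 vectorial_part \<Omega> f x \<noteq> 0 \<longrightarrow> span {vectorial_part \<Omega> f x} = L))"
    (is "(?i \<longleftrightarrow> ?ii) \<and> (?i \<longleftrightarrow> ?iii)")
proof -
  note \<Omega> = assms(1) and f = assms(2)
  obtain f0 f1 f2 f3 where comp: "slice_components \<Omega> f = (f0, f1, f2, f3)"
    by (metis prod_cases4)
  have "slice_decomposition \<Omega> f (slice_components \<Omega> f)"
    unfolding slice_components_def using slice_decomposition_exists [OF \<Omega> f] by (rule someI_ex)
  then have f0: "slice_preserving \<Omega> f0" and f1: "slice_preserving \<Omega> f1"
    and f2: "slice_preserving \<Omega> f2" and f3: "slice_preserving \<Omega> f3"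
    and f_eq: "\<And>q. q \<in> \<Omega> \<Longrightarrow> f q = f0 q + f1 q * quat_i + f2 q * quat_j + f3 q * quat_k"
    by (simp_all add: comp slice_decomposition_def)
  define fv where "fv = vectorial_part \<Omega> f"
  define fs where "fs = symmetrized_vectorial_part \<Omega> f"
  have fv_eq: "fv q = f1 q * quat_i + f2 q * quat_j + f3 q * quat_k" for q
    by (simp add: fv_def vectorial_part_def comp)
  have fs_eq: "fs q = (f1 q)\<^sup>2 + (f2 q)\<^sup>2 + (f3 q)\<^sup>2" for q
    by (simp add: fs_def symmetrized_vectorial_part_def comp)
  note real = slice_preserving_of_real
  \<comment> \<open>At real points the components are real, so they are exactly the coordinates of
    the imaginary quaternion \<open>fv\<close>.\<close>
  have fv_real: "Q0 (fv (of_real x)) = 0 \<and> f1 (of_real x) = of_real (Q1 (fv (of_real x))) \<and>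
    f2 (of_real x) = of_real (Q2 (fv (of_real x))) \<and> f3 (of_real x) = of_real (Q3 (fv (of_real x)))"
    if x: "of_real x \<in> \<Omega>" for x
  proof -
    obtain a b c where
      "f1 (of_real x) = of_real a" "f2 (of_real x) = of_real b" "f3 (of_real x) = of_real c"
      using real [OF f1 x] real [OF f2 x] real [OF f3 x] by blast
    then show ?thesis
      by (simp add: fv_eq quat_sel_times)
  qed
  have ball_reals: "(\<forall>x\<in>\<Omega> \<inter> \<real>. P x) \<longleftrightarrow> (\<forall>x. of_real x \<in> \<Omega> \<longrightarrow> P (of_real x))" for P
    by (auto simp: Reals_def)
  have iii_iff: "?iii \<longleftrightarrow> (\<exists>L\<in>proj_Im_quat. \<forall>x. of_real x \<in> \<Omega> \<longrightarrow>
      fv (of_real x) \<noteq> 0 \<longrightarrow> span {fv (of_real x)} = L)"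
    unfolding fv_def ball_reals by (rule refl)

  \<comment> \<open>The common line is that of \<open>J\<close>. At a real point \<open>f\<close>
    lies in the plane of \<open>J\<close> and \<open>f0\<close> is real, so \<open>fv\<close>, being
    imaginary, is a real multiple of \<open>J\<close>.\<close>
  have i_iii: ?iii if ?i
  proof -
    obtain J where J: "J \<in> imag_units" and fJ: "f ` (\<Omega> \<inter> slice_plane J) \<subseteq> slice_plane J"
      using \<open>?i\<close> by (auto simp: one_slice_preserving_def)
    have "Q0 J = 0" "J \<noteq> 0"
      using J by (auto simp: imag_units_iff)
    then have "span {J} \<in> proj_Im_quat"
      by (auto simp: proj_Im_quat_def Im_quat_iff)
    moreover have "span {fv (of_real x)} = span {J}"
      if x: "of_real x \<in> \<Omega>" and nz: "fv (of_real x) \<noteq> 0" for x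
    proof -
      have "of_real x \<in> slice_plane J"
        by (metis rangeI slice_plane_eq slice_point_of_real)
      then have "f (of_real x) \<in> slice_plane J"
        using fJ x by blast
      then obtain w where w: "f (of_real x) = slice_point J w"
        by (auto simp: slice_plane_eq)
      have "fv (of_real x) = f (of_real x) - of_real (Q0 (f0 (of_real x)))"
        using f_eq [OF x] real [OF f0 x] by (simp add: fv_eq)
      then have "fv (of_real x) = Im w *\<^sub>R J"
        using fv_real [OF x] \<open>Q0 J = 0\<close> w by (simp add: slice_point_eq quat_eq_iff)
      then show ?thesis
        using nz by (simp add: span_scaleR_singleton)
    qed
    ultimately show ?iii
      unfolding iii_iff by blast
  qed

  have ii_iii: ?iii if ?ii
  proof -
    obtain \<sigma> c where \<sigma>: "slice_preserving \<Omega> \<sigma>" "\<And>q. q \<in> \<Omega> \<Longrightarrow> (\<sigma> q)\<^sup>2 = fs q"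
      and c: "\<And>q. q \<in> \<Omega> \<Longrightarrow> fs q \<noteq> 0 \<Longrightarrow> inverse (\<sigma> q) * fv q = c"
      using \<open>?ii\<close>
      by (auto simp: is_square_root_def constant_on_def slice_quotient_def fv_def fs_def)
    \<comment> \<open>At a real point \<open>fs\<close> is the squared norm of \<open>fv\<close>, so
      it is nonzero and \<open>c\<close> is the quotient there. The value of \<sigma> is real and
      nonzero and serves as \<open>r\<close>.\<close>
    have dir: "\<exists>r. r \<noteq> 0 \<and> fv (of_real x) = r *\<^sub>R c"
      if x: "of_real x \<in> \<Omega>" and nz: "fv (of_real x) \<noteq> 0" for x
    proof -
      let ?v = "fv (of_real x)"
      have "fs (of_real x) = of_real ((Q1 ?v)\<^sup>2 + (Q2 ?v)\<^sup>2 + (Q3 ?v)\<^sup>2)"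
        using fv_real [OF x] by (simp add: fs_eq)
      moreover have "(Q1 ?v)\<^sup>2 + (Q2 ?v)\<^sup>2 + (Q3 ?v)\<^sup>2 \<noteq> 0"
        using nz fv_real [OF x] quat_normsq_eq_0 [of ?v] by simp
      ultimately have fs: "fs (of_real x) \<noteq> 0"
        by (metis of_real_eq_0_iff)
      then have "\<sigma> (of_real x) \<noteq> 0"
        using \<sigma>(2) [OF x] by auto
      moreover from this have "?v = \<sigma> (of_real x) * c"
        unfolding c [OF x fs, symmetric] by (simp flip: mult.assoc)
      ultimately show ?thesis
        using real [OF \<sigma>(1) x] by (metis of_real_0 scaleR_conv_of_real)
    qed
    \<comment> \<open>A real point with nonzero \<open>fv\<close> shows that \<open>c\<close> is
      imaginary and nonzero. If there is none, any line satisfies the condition vacuously, for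
      instance that of \<open>quat_i\<close>.\<close>
    show ?iii
    proof (cases "\<exists>x. of_real x \<in> \<Omega> \<and> fv (of_real x) \<noteq> 0")
      case True
      then obtain x where x: "of_real x \<in> \<Omega>" "fv (of_real x) \<noteq> 0"
        by blast
      then obtain r where "r \<noteq> 0" "fv (of_real x) = r *\<^sub>R c"
        using dir by blast
      then have "Q0 c = 0" "c \<noteq> 0"
        using fv_real [OF x(1)] x by auto
      then have "span {c} \<in> proj_Im_quat"
        by (auto simp: proj_Im_quat_def Im_quat_iff)
      moreover have "span {fv (of_real x)} = span {c}"
        if "of_real x \<in> \<Omega>" "fv (of_real x) \<noteq> 0" for x
        using dir [OF that] by (auto simp: span_scaleR_singleton)
      ultimately show ?thesis
        unfolding iii_iff by blast
    next
      case False
      moreover have "span {quat_i} \<in> proj_Im_quat"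
        by (auto simp: proj_Im_quat_def Im_quat_iff quat_eq_iff)
      ultimately show ?thesis
        unfolding iii_iff by blast
    qed
  qed

  have iii: "?i \<and> ?ii" if ?iii
  proof -
    obtain u where u: "Q0 u = 0" "u \<noteq> 0"
      and dir: "\<And>x. of_real x \<in> \<Omega> \<Longrightarrow> fv (of_real x) \<noteq> 0 \<Longrightarrow> span {fv (of_real x)} = span {u}"
      using \<open>?iii\<close> unfolding iii_iff by (auto simp: proj_Im_quat_def Im_quat_iff)
    define v where "v = u /\<^sub>R norm u"
    have "norm v = 1"
      using u by (simp add: v_def)
    then have v: "v \<in> imag_units" "(Q1 v)\<^sup>2 + (Q2 v)\<^sup>2 + (Q3 v)\<^sup>2 = 1"
      using u by (auto simp: imag_units_iff norm_quat_def v_def)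
    \<comment> \<open>At real points \<open>t\<close> is the signed length of \<open>fv\<close>
      along \<open>v\<close>. Unlike the norm, it is a real linear combination of the components and
      so remains slice preserving.\<close>
    define t where "t q = Q1 v *\<^sub>R f1 q + Q2 v *\<^sub>R f2 q + Q3 v *\<^sub>R f3 q" for q
    have t: "slice_preserving \<Omega> t"
      unfolding t_def by (intro slice_preserving_add slice_preserving_scaleR f1 f2 f3)
    have on_reals: "f1 (of_real x) = Q1 v *\<^sub>R t (of_real x) \<and>
        f2 (of_real x) = Q2 v *\<^sub>R t (of_real x) \<and> f3 (of_real x) = Q3 v *\<^sub>R t (of_real x)"
      if x: "of_real x \<in> \<Omega>" for x
    proof -
      \<comment> \<open>Where \<open>fv\<close> vanishes its direction is undefined, but 0 lies on
        the line anyway.\<close>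
      have "fv (of_real x) \<in> span {u}"
        using dir [OF x] span_base [of "fv (of_real x)" "{fv (of_real x)}"]
        by (cases "fv (of_real x) = 0") (auto simp: span_zero)
      moreover have "u = norm u *\<^sub>R v"
        using u by (simp add: v_def)
      ultimately obtain c where "fv (of_real x) = c *\<^sub>R v"
        by (metis (no_types, lifting) rangeE scaleR_scaleR span_singleton)
      then have c: "f1 (of_real x) = of_real (c * Q1 v)" "f2 (of_real x) = of_real (c * Q2 v)"
        "f3 (of_real x) = of_real (c * Q3 v)"
        using fv_real [OF x] by simp_all
      have "t (of_real x) = of_real (c * ((Q1 v)\<^sup>2 + (Q2 v)\<^sup>2 + (Q3 v)\<^sup>2))"
        unfolding t_def c by (simp add: quat_eq_iff power2_eq_square algebra_simps
            del: of_real_mult of_real_add)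
      then show ?thesis
        by (simp add: v c quat_eq_iff del: of_real_mult)
    qed
    have reg: "slice_regular \<Omega> (\<lambda>q. r *\<^sub>R t q)" for r
      by (intro slice_regular_scaleR slice_preserving_imp_slice_regular t)
    note identity = slice_regular_identity_principle [OF \<Omega> slice_preserving_imp_slice_regular reg]
    \<comment> \<open>Proportionality at real points becomes proportionality on the whole domain by
      the identity principle.\<close>
    have fn: "f1 q = Q1 v *\<^sub>R t q" "f2 q = Q2 v *\<^sub>R t q" "f3 q = Q3 v *\<^sub>R t q" if q: "q \<in> \<Omega>" for q
      using identity [OF f1 _ q] identity [OF f2 _ q] identity [OF f3 _ q] on_reals by blast+
    have fv_tv: "fv q = t q * v" if "q \<in> \<Omega>" for q
    proof -
      have "v = Q1 v *\<^sub>R quat_i + Q2 v *\<^sub>R quat_j + Q3 v *\<^sub>R quat_k"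
        using v by (simp add: quat_eq_iff imag_units_iff)
      then have "t q * v = t q * (Q1 v *\<^sub>R quat_i + Q2 v *\<^sub>R quat_j + Q3 v *\<^sub>R quat_k)"
        by simp
      then show ?thesis
        by (simp add: fv_eq fn that distrib_left)
    qed
    have fs_t: "(t q)\<^sup>2 = fs q" if "q \<in> \<Omega>" for q
    proof -
      have "fs q = ((Q1 v)\<^sup>2 + (Q2 v)\<^sup>2 + (Q3 v)\<^sup>2) *\<^sub>R (t q)\<^sup>2"
        by (simp add: fs_eq fn that power2_eq_square scaleR_add_left)
      then show ?thesis
        by (simp add: v)
    qed
    \<comment> \<open>On this plane \<open>f0\<close> and \<open>t\<close> take values in it, and it
      is closed under products, so \<open>f0 + t v\<close> stays in it.\<close>
    have "f q \<in> slice_plane v" if q: "q \<in> \<Omega>" "q \<in> slice_plane v" for q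
    proof -
      have "f q = f0 q + t q * v"
        using f_eq [OF q(1)] fv_tv [OF q(1)] by (simp add: fv_eq add.assoc)
      moreover have "f0 q \<in> slice_plane v" "t q \<in> slice_plane v"
        using slice_preserving_in_slice_plane v q f0 t by blast+
      moreover have "v \<in> slice_plane v"
        by (simp add: slice_plane_def span_base)
      ultimately show ?thesis
        using slice_plane_mult [OF v(1)] by (simp add: slice_plane_def span_add)
    qed
    then have ?i
      using f v by (auto simp: one_slice_preserving_def)
    \<comment> \<open>The factor \<open>t q\<close> stands to the left of \<open>v\<close>, so the
      left inverse in the quotient cancels it.\<close>
    moreover have "slice_quotient fv t q = v" if "q \<in> \<Omega>" "fs q \<noteq> 0" for q
    proof -
      have "t q \<noteq> 0"
        using fs_t that by fastforce
      then show ?thesis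
        by (simp add: slice_quotient_def fv_tv that flip: mult.assoc)
    qed
    then have ?ii
      using t fs_t by (auto simp: is_square_root_def constant_on_def fv_def fs_def intro!: exI [of _ t])
    ultimately show ?thesis ..
  qed
  show ?thesis
    using i_iii ii_iii iii by blast
qed

end
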